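(* Let $X$ and $Y$ be two topologically transitive one-dimensional subshifts of finite type (i.e. over the group $\mathbb{Z}$). Then $X$ and $Y$ are homotopy equivalent if and only if they map into each other, i.e. there exist block maps $X \to Y$ and $Y \to X$.
   Context: For a finite set $A$ (alphabet), $A^{\mathbb{Z}}$ carries the product topology (discrete $A$) and the $\mathbb{Z}$-shift action $(n \cdot x)_m = x_{m-n}$. A subshift is a topologically closed, shift-invariant subset $X \subset A^{\mathbb{Z}}$. $X$ is of finite type (SFT) if there is a finite set of finite words such that $X$ is the set of all $x \in A^{\mathbb{Z}}$ in which none of these words appears. $X$ is (topologically) transitive, also called irreducible, if for any two words $u, v$ appearing in points of $X$ there is a word $w$ such that $uwv$ appears in a point of $X$. A block map (morphism) between subshifts is a continuous shift-commuting map, not necessarily surjective; products carry the diagonal action. Let $I = \{0,1\}^{\mathbb{Z}}$, with constant configurations $\bar 0, \bar 1$. Two block maps $f, g : X \to Y$ are homotopic, $f \cong g$, if there is a block map $h : I \times X \to Y$ with $h(\bar 0, x) = f(x)$ and $h(\bar 1, x) = g(x)$ for all $x \in X$. Two subshifts $X, Y$ are homotopy equivalent if there are block maps $f : X \to Y$ and $g : Y \to X$ such that $g \circ f \cong \mathrm{id}_X$ and $f \circ g \cong \mathrm{id}_Y$. *)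

theory Defs
  imports "HOL-Analysis.Analysis"
begin

text \<open>
  Alphabets are finite sets \<open>A :: 'a set\<close>, so \<open>A\<close> may be empty and \<open>'a\<close> need not be a finite type.
  Maps between subshifts are total HOL functions; only their values on the domain subshift matter.
\<close>

definition shift_topology :: "'a set \<Rightarrow> (int \<Rightarrow> 'a) topology" where
  "shift_topology A = product_topology (\<lambda>_. discrete_topology A) UNIV"

definition shift :: "int \<Rightarrow> (int \<Rightarrow> 'a) \<Rightarrow> int \<Rightarrow> 'a" where
  "shift n x = (\<lambda>m. x (m - n))"

definition subshift :: "'a set \<Rightarrow> (int \<Rightarrow> 'a) set \<Rightarrow> bool" where
  "subshift A X \<longleftrightarrow>
     finite A \<and> closedin (shift_topology A) X \<and> (\<forall>n. \<forall>x\<in>X. shift n x \<in> X)"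

definition subshift_topology :: "'a set \<Rightarrow> (int \<Rightarrow> 'a) set \<Rightarrow> (int \<Rightarrow> 'a) topology" where
  "subshift_topology A X = subtopology (shift_topology A) X"

definition appears_in :: "'a list \<Rightarrow> (int \<Rightarrow> 'a) \<Rightarrow> bool" where
  "appears_in w x \<longleftrightarrow> (\<exists>i. \<forall>k<length w. x (i + int k) = w ! k)"

definition finite_type :: "'a set \<Rightarrow> (int \<Rightarrow> 'a) set \<Rightarrow> bool" where
  "finite_type A X \<longleftrightarrow>
     (\<exists>F. finite F \<and> F \<subseteq> lists A \<and>
          X = {x \<in> topspace (shift_topology A). \<forall>w\<in>F. \<not> appears_in w x})"

definition sft :: "'a set \<Rightarrow> (int \<Rightarrow> 'a) set \<Rightarrow> bool" where
  "sft A X \<longleftrightarrow> subshift A X \<and> finite_type A X"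

definition language :: "(int \<Rightarrow> 'a) set \<Rightarrow> 'a list set" where
  "language X = {w. \<exists>x\<in>X. appears_in w x}"

text \<open>The connecting word \<open>w\<close> below may be empty. The empty subshift is transitive.\<close>

definition transitive_subshift :: "(int \<Rightarrow> 'a) set \<Rightarrow> bool" where
  "transitive_subshift X \<longleftrightarrow>
     (\<forall>u\<in>language X. \<forall>v\<in>language X. \<exists>w. u @ w @ v \<in> language X)"

text \<open>
  Morphisms are defined for arbitrary spaces with an integer action, so that a product of subshifts
  (carrying the product topology and the diagonal action) is literally a product and need not be
  recoded as a subshift over a product alphabet.
\<close>

definition equivariant_map ::
  "'x topology \<Rightarrow> (int \<Rightarrow> 'x \<Rightarrow> 'x) \<Rightarrow> 'y topology \<Rightarrow> (int \<Rightarrow> 'y \<Rightarrow> 'y) \<Rightarrow> ('x \<Rightarrow> 'y) \<Rightarrow> bool"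
  where
  "equivariant_map S a T b f \<longleftrightarrow>
     continuous_map S T f \<and> (\<forall>n. \<forall>x\<in>topspace S. f (a n x) = b n (f x))"

definition block_map ::
  "'a set \<Rightarrow> (int \<Rightarrow> 'a) set \<Rightarrow> 'b set \<Rightarrow> (int \<Rightarrow> 'b) set \<Rightarrow> ((int \<Rightarrow> 'a) \<Rightarrow> int \<Rightarrow> 'b) \<Rightarrow> bool"
  where
  "block_map A X B Y f \<longleftrightarrow>
     equivariant_map (subshift_topology A X) shift (subshift_topology B Y) shift f"

definition diagonal_shift ::
  "int \<Rightarrow> (int \<Rightarrow> 'a) \<times> (int \<Rightarrow> 'b) \<Rightarrow> (int \<Rightarrow> 'a) \<times> (int \<Rightarrow> 'b)" where
  "diagonal_shift n p = (shift n (fst p), shift n (snd p))"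

definition interval_topology :: "(int \<Rightarrow> nat) topology" where
  "interval_topology = shift_topology {0, 1}"

definition homotopic_block_maps ::
  "'a set \<Rightarrow> (int \<Rightarrow> 'a) set \<Rightarrow> 'b set \<Rightarrow> (int \<Rightarrow> 'b) set \<Rightarrow>
   ((int \<Rightarrow> 'a) \<Rightarrow> int \<Rightarrow> 'b) \<Rightarrow> ((int \<Rightarrow> 'a) \<Rightarrow> int \<Rightarrow> 'b) \<Rightarrow> bool"
  where
  "homotopic_block_maps A X B Y f g \<longleftrightarrow>
     block_map A X B Y f \<and> block_map A X B Y g \<and>
     (\<exists>h. equivariant_map
             (prod_topology interval_topology (subshift_topology A X)) diagonal_shift
             (subshift_topology B Y) shift h \<and>
          (\<forall>x\<in>X. h ((\<lambda>_. 0), x) = f x \<and> h ((\<lambda>_. 1), x) = g x))"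

definition homotopy_equivalent_subshifts ::
  "'a set \<Rightarrow> (int \<Rightarrow> 'a) set \<Rightarrow> 'b set \<Rightarrow> (int \<Rightarrow> 'b) set \<Rightarrow> bool"
  where
  "homotopy_equivalent_subshifts A X B Y \<longleftrightarrow>
     (\<exists>f g. block_map A X B Y f \<and> block_map B Y A X g \<and>
            homotopic_block_maps A X A X (g \<circ> f) id \<and>
            homotopic_block_maps B Y B Y (f \<circ> g) id)"

end

theory Submission
  imports Defs
begin

text \<open>
  Call \<open>x\<close> and \<open>y\<close> bi-asymptotic if some point of the subshift is left asymptotic to \<open>x\<close> and right
  asymptotic to \<open>y\<close>. On a transitive SFT this is an equivalence relation (\<open>x\<close> and \<open>y\<close> have the same
  phase with respect to the period), any two points are bi-asymptotic up to a shift, and one can pass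
  from \<open>x\<close> to \<open>y\<close> within a uniformly bounded time. Block maps preserve the relation.

  If \<open>f z\<close> and \<open>g z\<close> are always bi-asymptotic then \<open>f\<close> and \<open>g\<close> are homotopic: follow \<open>g z\<close> on the long
  runs of ones of the interval coordinate and \<open>f z\<close> elsewhere, and insert bridges at the two ends of
  each long run. Given \<open>f\<close> from \<open>X\<close> to \<open>Y\<close> and \<open>g\<close> back, composing \<open>g\<close> with a suitable shift makes
  \<open>x\<close> and \<open>g (f x)\<close> bi-asymptotic for one point \<open>x\<close>, hence for all. Applying \<open>f\<close> to this, and using
  that every point of \<open>Y\<close> is bi-asymptotic to a shift of some \<open>f x\<close>, gives the same for \<open>f \<circ> g\<close>.
\<close>

section \<open>Numerical semigroups and periods of strongly connected relations\<close>

text \<open>Take \<open>p\<close> as the least positive difference of two elements of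
  \<open>S\<close>, realised by \<open>b\<close> and \<open>b + p\<close>. If \<open>p\<close> did
  not divide \<open>a\<close>, then \<open>b + q * (b + p)\<close> and
  \<open>a + (q + 1) * b\<close> would differ by \<open>a mod p\<close>, which is positive and
  smaller. With \<open>b = p * k\<close> and \<open>n = p * j\<close>, the number \<open>n\<close>
  is a sum of \<open>j div k\<close> terms, of which \<open>j mod k\<close> are \<open>b + p\<close>
  and the others \<open>b\<close>; this makes sense as soon as
  \<open>j div k > j mod k\<close>.\<close>

lemma numerical_semigroup:
  fixes S :: "nat set"
  assumes "s \<in> S" "s > 0" and add: "\<And>a b. a \<in> S \<Longrightarrow> b \<in> S \<Longrightarrow> a + b \<in> S"
  shows "\<exists>p>0. (\<forall>a\<in>S. p dvd a) \<and> (\<exists>K. \<forall>n\<ge>K. p dvd n \<longrightarrow> n \<in> S)"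
proof -
  define P where "P d \<longleftrightarrow> d > 0 \<and> (\<exists>a\<in>S. a + d \<in> S)" for d
  define p where "p = (LEAST d. P d)"
  have "P s" unfolding P_def using assms by auto
  then have "P p" unfolding p_def by (rule LeastI)
  then obtain b0 where b0: "b0 \<in> S" "b0 + p \<in> S" and p: "p > 0"
    unfolding P_def by auto
  \<comment> \<open>The least difference may be realised at \<open>b0 = 0\<close>; adding
    \<open>s\<close> makes \<open>b\<close>, and hence \<open>k\<close> below, positive.\<close>
  define b where "b = b0 + s"
  have b: "b \<in> S" "b + p \<in> S" "b > 0"
    using add[OF b0(1) assms(1)] add[OF b0(2) assms(1)] assms(2)
    by (simp_all add: b_def ac_simps)
  have add_mult: "c + n * a \<in> S" if "c \<in> S" "a \<in> S" for c n a
    using that by (induction n) (auto simp: add.left_commute intro: add)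
  have dvd: "p dvd a" if a: "a \<in> S" for a
  proof (rule ccontr)
    assume "\<not> p dvd a"
    then have r: "a mod p > 0" by (simp add: dvd_eq_mod_eq_0)
    define q where "q = a div p"
    have *: "b + q * (b + p) \<in> S" using add_mult[OF b(1) b(2)] .
    have "a + (q + 1) * b \<in> S" using add_mult[OF a b(1)] .
    also have "a + (q + 1) * b = (b + q * (b + p)) + a mod p"
      using div_mult_mod_eq[of a p] by (simp add: q_def algebra_simps)
    finally have "P (a mod p)" unfolding P_def using r * by blast
    then have "p \<le> a mod p" unfolding p_def by (rule Least_le)
    then show False using p by (meson mod_less_divisor not_le)
  qed
  obtain k where k: "b = p * k" using dvd[OF b(1)] by (auto simp: dvd_def)
  have "k > 0" using b(3) k by simp
  have "n \<in> S" if n: "n \<ge> k * k * p" "p dvd n" for n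
  proof -
    obtain j where j: "n = p * j" using n(2) by (auto simp: dvd_def)
    have "k * k \<le> j" using n(1) p by (simp add: j ac_simps)
    then have "k \<le> j div k" using \<open>k > 0\<close> by (simp add: less_eq_div_iff_mult_less_eq)
    moreover have "j mod k < k" using \<open>k > 0\<close> by simp
    ultimately obtain t where t: "j div k = j mod k + Suc t"
      using less_imp_Suc_add[of "j mod k" "j div k"] by auto
    have "n = (b + t * b) + (j mod k) * (b + p)"
    proof -
      have "j = (j mod k + Suc t) * k + j mod k" using div_mult_mod_eq[of j k] t by simp
      then have "n = p * ((j mod k + Suc t) * k + j mod k)" using j by simp
      then show ?thesis by (simp add: k algebra_simps)
    qed
    then show ?thesis using add_mult[OF add_mult[OF b(1) b(1)] b(2)] by simp
  qed
  then show ?thesis using p dvd by blast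
qed

lemma mod_add_cancel_nat:
  fixes a b m n p :: nat
  shows "(a + m + b) mod p = (a + n + b) mod p \<longleftrightarrow> m mod p = n mod p"
  by (auto simp: nat_mod_eq_iff algebra_simps)

text \<open>Read \<open>R m u v\<close> as a path of length \<open>m\<close> from \<open>u\<close>
  to \<open>v\<close>. The loop lengths at a base point \<open>u0\<close> form a numerical
  semigroup, and its \<open>p\<close> is the period. Closing two paths with the same ends to loops
  at \<open>u0\<close> shows that their lengths agree modulo \<open>p\<close>. Conversely, any long
  enough length in the right class is realised by a path through \<open>u0\<close>, with a loop
  there taking up the excess.\<close>

lemma strongly_connected_period:
  fixes R :: "nat \<Rightarrow> 's \<Rightarrow> 's \<Rightarrow> bool"
  assumes "finite S"
    and dom: "\<And>m u v. R m u v \<Longrightarrow> u \<in> S \<and> v \<in> S"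
    and comp: "\<And>m n u v w. R m u v \<Longrightarrow> R n v w \<Longrightarrow> R (m + n) u w"
    and conn: "\<And>u v. u \<in> S \<Longrightarrow> v \<in> S \<Longrightarrow> \<exists>m>0. R m u v"
  obtains p N :: nat where "p > 0" "N > 0"
    "\<And>u v m n. R m u v \<Longrightarrow> R n u v \<Longrightarrow> m mod p = n mod p"
    "\<And>u v m n. R m u v \<Longrightarrow> n \<ge> N \<Longrightarrow> n mod p = m mod p \<Longrightarrow> R n u v"
proof (cases "S = {}")
  case True
  then have "\<not> R m u v" for m u v using dom by blast
  then show thesis using that[of 1 1] by auto
next
  case False
  then obtain u0 where u0: "u0 \<in> S" by blast
  obtain s where s: "s > 0" "R s u0 u0" using conn u0 by blast
  obtain p K where p: "p > 0" and dvd: "\<And>a. R a u0 u0 \<Longrightarrow> p dvd a"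
    and K: "\<And>n. n \<ge> K \<Longrightarrow> p dvd n \<Longrightarrow> R n u0 u0"
    using numerical_semigroup[of s "{a. R a u0 u0}"] s comp by blast
  have "\<forall>u\<in>S. \<exists>m. R m u u0" "\<forall>u\<in>S. \<exists>m. R m u0 u" using conn u0 by blast+
  then obtain c d where c: "\<And>u. u \<in> S \<Longrightarrow> R (c u) u u0" and d: "\<And>u. u \<in> S \<Longrightarrow> R (d u) u0 u"
    by metis
  have cong: "m mod p = n mod p" if "R m u v" "R n u v" for m n u v
  proof -
    have uv: "u \<in> S" "v \<in> S" using dom that by blast+
    have "p dvd d u + m + c v" "p dvd d u + n + c v"
      using that comp[OF comp[OF d[OF uv(1)]] c[OF uv(2)]] dvd by blast+
    then have "(d u + m + c v) mod p = (d u + n + c v) mod p" by simp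
    then show ?thesis by (simp only: mod_add_cancel_nat)
  qed
  \<comment> \<open>Room for the longest chosen way into \<open>u0\<close>, the longest way out, and
    a loop of length at least \<open>K\<close>.\<close>
  define N where "N = Suc (K + Max (c ` S) + Max (d ` S))"
  show thesis
  proof (rule that[OF p _ cong])
    show "N > 0" by (simp add: N_def)
    fix u v m n assume uv: "R m u v" and n: "N \<le> n" "n mod p = m mod p"
    have uS: "u \<in> S" "v \<in> S" using dom uv by blast+
    have "c u \<le> Max (c ` S)" "d v \<le> Max (d ` S)" using uS \<open>finite S\<close> by auto
    then have le: "K + c u + d v \<le> n" using n(1) N_def by linarith
    \<comment> \<open>A comparison path whose loop has length divisible by \<open>p\<close>: it puts
      \<open>c u + d v\<close> in the residue class of \<open>n\<close>, so the loop that completes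
      a path of length \<open>n\<close> has an admissible length.\<close>
    have "R (c u + K * p + d v) u v"
      using comp[OF comp[OF c[OF uS(1)] K[of "K * p"]] d[OF uS(2)]] p by simp
    then have "(c u + K * p + d v) mod p = n mod p" using cong[OF _ uv] n(2) by simp
    then have "(c u + d v) mod p = n mod p" by (metis add.commute add.left_commute mod_mult_self1)
    then have "p dvd n - (c u + d v)" using le
      by (metis mod_eq_dvd_iff_nat add.commute add.assoc add_leD2 le_trans le_add2)
    then have "R (n - (c u + d v)) u0 u0" using K le by simp
    then have "R (c u + (n - (c u + d v)) + d v) u v"
      using comp[OF comp[OF c[OF uS(1)]] d[OF uS(2)]] by blast
    then show "R n u v" using le by (simp add: algebra_simps)
  qed auto
qed

section \<open>Subshifts and block maps\<close>

lemma shift_apply [simp]: "shift n x m = x (m - n)"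
  by (simp add: shift_def)

lemma shift_shift [simp]: "shift m (shift n x) = shift (m + n) x"
  by (simp add: fun_eq_iff algebra_simps)

lemma topspace_shift_topology: "topspace (shift_topology A) = {x. \<forall>n. x n \<in> A}"
  by (auto simp: shift_topology_def PiE_UNIV_domain)

lemma subshift_in_alphabet: "subshift A X \<Longrightarrow> x \<in> X \<Longrightarrow> x n \<in> A"
  unfolding subshift_def using closedin_subset topspace_shift_topology by blast

lemma subshift_shift: "subshift A X \<Longrightarrow> x \<in> X \<Longrightarrow> shift n x \<in> X"
  unfolding subshift_def by blast

lemma topspace_subshift: "subshift A X \<Longrightarrow> topspace (subshift_topology A X) = X"
  unfolding subshift_def subshift_topology_def
  by (auto dest: closedin_subset)

lemma continuous_map_into_subshift_iff:
  "continuous_map S (subshift_topology A X) f \<longleftrightarrow>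
     (\<forall>n. continuous_map S (discrete_topology A) (\<lambda>p. f p n)) \<and> f \<in> topspace S \<rightarrow> X"
  unfolding subshift_topology_def continuous_map_in_subtopology shift_topology_def
    continuous_map_componentwise_UNIV
  by auto

lemma continuous_map_discrete_local:
  assumes "\<And>p. p \<in> topspace S \<Longrightarrow> f p \<in> C"
    and "\<And>p. p \<in> topspace S \<Longrightarrow> \<exists>U. openin S U \<and> p \<in> U \<and> (\<forall>q\<in>U. f q = f p)"
  shows "continuous_map S (discrete_topology C) f"
  unfolding continuous_map_def
proof (intro conjI allI impI)
  show "f \<in> topspace S \<rightarrow> topspace (discrete_topology C)" using assms(1) by auto
  fix V
  show "openin S {x \<in> topspace S. f x \<in> V}"
  proof (subst openin_subopen, safe)
    fix p assume p: "p \<in> topspace S" "f p \<in> V"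
    then obtain U where U: "openin S U" "p \<in> U" "\<forall>q\<in>U. f q = f p" using assms(2) by blast
    then have "U \<subseteq> {x \<in> topspace S. f x \<in> V}" using p openin_subset by fastforce
    then show "\<exists>T. openin S T \<and> p \<in> T \<and> T \<subseteq> {x \<in> topspace S. f x \<in> V}" using U by blast
  qed
qed

text \<open>The domain of \<open>c\<close> is an arbitrary space so that the lemma covers block maps
  and also the coordinates of the product on which a homotopy lives.\<close>

lemma window_neighbourhood:
  fixes c :: "'p \<Rightarrow> int \<Rightarrow> 'a"
  assumes "continuous_map S (shift_topology A) c" "p \<in> topspace S" "finite W"
  shows "\<exists>U. openin S U \<and> p \<in> U \<and> (\<forall>q\<in>U. \<forall>k\<in>W. c q k = c p k)"
proof -
  define V where "V k = {q \<in> topspace S. c q k \<in> {c p k}}" for k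
  have V: "openin S (V k)" for k
  proof -
    have c: "continuous_map S (discrete_topology A) (\<lambda>p. c p k)"
      using assms(1) unfolding shift_topology_def continuous_map_componentwise_UNIV by blast
    then have "c p k \<in> A" using assms(2) by (auto simp: continuous_map_def)
    then have "openin (discrete_topology A) {c p k}" by simp
    then show ?thesis unfolding V_def using c by (simp only: continuous_map_def)
  qed
  have "openin S (topspace S \<inter> (\<Inter>k\<in>W. V k))"
    using \<open>finite W\<close>
  proof (induction W rule: finite_induct)
    case (insert k W)
    then have "openin S (V k \<inter> (topspace S \<inter> (\<Inter>k\<in>W. V k)))" using V by blast
    then show ?case by (simp add: Int_left_commute)
  qed simp
  then show ?thesis using assms(2)
    by (intro exI[of _ "topspace S \<inter> (\<Inter>k\<in>W. V k)"]) (auto simp: V_def)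
qed

lemma block_map_continuous:
  "block_map A X B Y f \<Longrightarrow> continuous_map (subshift_topology A X) (shift_topology B) f"
  unfolding block_map_def equivariant_map_def
  using continuous_map_into_fulltopology subshift_topology_def by metis

lemma block_map_in:
  "block_map A X B Y f \<Longrightarrow> subshift A X \<Longrightarrow> x \<in> X \<Longrightarrow> f x \<in> Y"
  unfolding block_map_def equivariant_map_def continuous_map_into_subshift_iff
  by (auto simp: topspace_subshift)

lemma block_map_shift:
  "block_map A X B Y f \<Longrightarrow> subshift A X \<Longrightarrow> x \<in> X \<Longrightarrow> f (shift n x) = shift n (f x)"
  unfolding block_map_def equivariant_map_def by (auto simp: topspace_subshift)

lemma block_map_comp:
  assumes "block_map A X B Y f" "block_map B Y C Z g"
  shows "block_map A X C Z (g \<circ> f)"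
  unfolding block_map_def equivariant_map_def
proof (intro conjI allI ballI)
  show "continuous_map (subshift_topology A X) (subshift_topology C Z) (g \<circ> f)"
    using assms unfolding block_map_def equivariant_map_def by (blast intro: continuous_map_compose)
  fix n x assume x: "x \<in> topspace (subshift_topology A X)"
  then have "f x \<in> topspace (subshift_topology B Y)"
    using assms(1) unfolding block_map_def equivariant_map_def continuous_map_def by blast
  then show "(g \<circ> f) (shift n x) = shift n ((g \<circ> f) x)"
    using x assms unfolding block_map_def equivariant_map_def by simp
qed

lemma block_map_id: "block_map A X A X id"
  unfolding block_map_def equivariant_map_def by auto

lemma block_map_shift_self:
  assumes "subshift A X"
  shows "block_map A X A X (shift k)"
  unfolding block_map_def equivariant_map_def
proof (intro conjI allI ballI)
  have "continuous_map (subshift_topology A X) (discrete_topology A) (\<lambda>x. x n)" for n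
    using continuous_map_id[of "subshift_topology A X"]
    unfolding id_def continuous_map_into_subshift_iff by blast
  then show "continuous_map (subshift_topology A X) (subshift_topology A X) (shift k)"
    unfolding continuous_map_into_subshift_iff
    using assms by (auto simp: topspace_subshift intro: subshift_shift)
qed (simp add: add.commute)

lemma compact_space_subshift:
  assumes "subshift A X"
  shows "compact_space (subshift_topology A X)"
proof -
  have "compact_space (shift_topology A)"
    using assms unfolding shift_topology_def subshift_def
    by (simp add: compact_space_product_topology compact_space_discrete_topology)
  then show ?thesis
    using assms unfolding subshift_topology_def subshift_def
    by (simp add: closedin_compact_space compact_space_subtopology)
qed

text \<open>By continuity each point has a cylinder on which coordinate 0 of the image is constant.
  Compactness leaves finitely many of them, the largest radius serves for all points, and
  equivariance carries the result from coordinate 0 to every coordinate.\<close>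

lemma curtis_hedlund_lyndon:
  assumes f: "block_map A X B Y f" and X: "subshift A X"
  obtains r :: int where "r \<ge> 0"
    "\<And>x y n. x \<in> X \<Longrightarrow> y \<in> X \<Longrightarrow> (\<And>k. \<bar>k - n\<bar> \<le> r \<Longrightarrow> x k = y k) \<Longrightarrow> f x n = f y n"
proof -
  let ?S = "subshift_topology A X"
  have tX: "topspace ?S = X" using X by (rule topspace_subshift)
  have id: "continuous_map ?S (shift_topology A) (\<lambda>x. x)"
    using block_map_continuous[OF block_map_id] by (simp add: id_def)
  define cyl where "cyl x r = {y \<in> X. \<forall>k\<in>{-r..r}. y k = x k}" for x and r :: int
  have op: "openin ?S (cyl x r)" for x r
  proof (subst openin_subopen, safe)
    fix y assume y: "y \<in> cyl x r"
    then have "y \<in> topspace ?S" by (simp add: tX cyl_def)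
    then obtain U where U: "openin ?S U" "y \<in> U" "\<forall>q\<in>U. \<forall>k\<in>{-r..r}. q k = y k"
      using window_neighbourhood[OF id _ finite_atLeastAtMost_int] by meson
    have "U \<subseteq> cyl x r"
    proof
      fix q assume q: "q \<in> U"
      then have "q \<in> X" using openin_subset[OF U(1)] tX by blast
      moreover have "\<forall>k\<in>{-r..r}. q k = x k" using U(3) q y unfolding cyl_def by fastforce
      ultimately show "q \<in> cyl x r" by (simp add: cyl_def)
    qed
    then show "\<exists>T. openin ?S T \<and> y \<in> T \<and> T \<subseteq> cyl x r" using U by blast
  qed
  have ex: "\<exists>r. \<forall>y\<in>cyl x r. f y 0 = f x 0" if x: "x \<in> X" for x
  proof -
    have "x \<in> topspace ?S" using x by (simp add: tX)
    then obtain U where U: "openin ?S U" "x \<in> U" "\<forall>q\<in>U. \<forall>k\<in>{0}. f q k = f x k"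
      using window_neighbourhood[OF block_map_continuous[OF f], of x "{0}"] by blast
    obtain V where V: "openin (shift_topology A) V" "U = V \<inter> X"
      using U(1) unfolding subshift_topology_def openin_subtopology by blast
    obtain W where W: "finite {i. W i \<noteq> topspace (discrete_topology A)}"
      "x \<in> PiE UNIV W" "PiE UNIV W \<subseteq> V"
      using V U(2) unfolding shift_topology_def openin_product_topology_alt by (auto 4 4)
    \<comment> \<open>Outside this radius the basic open set only asks for letters of
      \<open>A\<close>. The inserted 0 keeps the maximum defined when no coordinate is
      constrained.\<close>
    define r where "r = Max (insert 0 (abs ` {i. W i \<noteq> topspace (discrete_topology A)}))"
    have "cyl x r \<subseteq> U"
    proof
      fix y assume y: "y \<in> cyl x r"
      have "y i \<in> W i" for i
      proof (cases "W i = A")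
        case True
        then show ?thesis using y X subshift_in_alphabet by (auto simp: cyl_def)
      next
        case False
        then have "\<bar>i\<bar> \<le> r" unfolding r_def using W(1) by (intro Max_ge) auto
        then have "y i = x i" using y by (auto simp: cyl_def abs_le_iff)
        then show ?thesis using W(2) by (auto simp: PiE_iff)
      qed
      then show "y \<in> U" using W(3) V(2) y by (auto simp: cyl_def)
    qed
    then show ?thesis using U(3) by blast
  qed
  then obtain R where R: "\<And>x y. x \<in> X \<Longrightarrow> y \<in> cyl x (R x) \<Longrightarrow> f y 0 = f x 0" by metis
  obtain \<F> where \<F>: "finite \<F>" "\<F> \<subseteq> (\<lambda>x. cyl x (R x)) ` X" "X \<subseteq> \<Union>\<F>"
  proof -
    have "compactin ?S X" using compact_space_subshift[OF X] by (simp add: compact_space_def tX)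
    moreover have "X \<subseteq> \<Union> ((\<lambda>x. cyl x (R x)) ` X)" by (auto simp: cyl_def)
    ultimately show thesis using that op unfolding compactin_def by (smt (verit) imageE)
  qed
  obtain X0 where X0: "finite X0" "X0 \<subseteq> X" "\<F> = (\<lambda>x. cyl x (R x)) ` X0"
    using \<F> finite_subset_image by metis
  define r where "r = Max (insert 0 (R ` X0))"
  have r: "r \<ge> 0" "\<And>x. x \<in> X0 \<Longrightarrow> R x \<le> r" unfolding r_def using X0(1) by auto
  have loc: "f x 0 = f y 0" if xy: "x \<in> X" "y \<in> X" "\<And>k. \<bar>k\<bar> \<le> r \<Longrightarrow> x k = y k" for x y
  proof -
    obtain z where z: "z \<in> X0" "x \<in> cyl z (R z)" using \<F>(3) X0(3) xy(1) by blast
    then have "y \<in> cyl z (R z)" using xy r(2)[OF z(1)] by (force simp: cyl_def)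
    then show ?thesis using R z X0(2) by (metis subsetD)
  qed
  show thesis
  proof (rule that[OF r(1)])
    fix x y n assume xy: "x \<in> X" "y \<in> X" "\<And>k. \<bar>k - n\<bar> \<le> r \<Longrightarrow> x k = y k"
    have "f (shift (-n) x) 0 = f (shift (-n) y) 0"
      using xy by (intro loc subshift_shift[OF X]) auto
    then show "f x n = f y n" using block_map_shift[OF f X] xy by simp
  qed
qed

section \<open>Bi-asymptotic points\<close>

definition bi_asymptotic :: "(int \<Rightarrow> 'a) set \<Rightarrow> (int \<Rightarrow> 'a) \<Rightarrow> (int \<Rightarrow> 'a) \<Rightarrow> bool" where
  "bi_asymptotic X x y \<longleftrightarrow>
     (\<exists>z\<in>X. \<exists>m n. (\<forall>k\<le>m. z k = x k) \<and> (\<forall>k\<ge>n. z k = y k))"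

lemma bi_asymptoticI:
  assumes "z \<in> X" "\<And>k. k \<le> m \<Longrightarrow> z k = x k" "\<And>k. k \<ge> n \<Longrightarrow> z k = y k"
  shows "bi_asymptotic X x y"
  unfolding bi_asymptotic_def using assms by blast

lemma bi_asymptotic_shift:
  assumes "subshift A X" "bi_asymptotic X x y"
  shows "bi_asymptotic X (shift s x) (shift s y)"
proof -
  obtain z m n where "z \<in> X" "\<forall>k\<le>m. z k = x k" "\<forall>k\<ge>n. z k = y k"
    using assms(2) unfolding bi_asymptotic_def by blast
  then show ?thesis
    by (intro bi_asymptoticI[of "shift s z" X "m + s" _ "n + s"] subshift_shift[OF assms(1)]) auto
qed

text \<open>The image of the connecting point connects the images: a block map is local, so each
  tail only loses as many positions as the radius.\<close>

lemma bi_asymptotic_block_map: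
  assumes f: "block_map A X B Y f" and X: "subshift A X" and "x \<in> X" "y \<in> X"
    and "bi_asymptotic X x y"
  shows "bi_asymptotic Y (f x) (f y)"
proof -
  obtain z m n where z: "z \<in> X" "\<forall>k\<le>m. z k = x k" "\<forall>k\<ge>n. z k = y k"
    using assms(5) unfolding bi_asymptotic_def by blast
  obtain r :: int where r: "r \<ge> 0"
    "\<And>x y n. x \<in> X \<Longrightarrow> y \<in> X \<Longrightarrow> (\<And>k. \<bar>k - n\<bar> \<le> r \<Longrightarrow> x k = y k) \<Longrightarrow> f x n = f y n"
    using curtis_hedlund_lyndon[OF f X] by blast
  show ?thesis
  proof (rule bi_asymptoticI[of "f z" Y "m - r" _ "n + r"])
    show "f z \<in> Y" using block_map_in[OF f X z(1)] .
    show "f z k = f x k" if "k \<le> m - r" for k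
      using that z(2) by (intro r(2) z(1) assms) auto
    show "f z k = f y k" if "k \<ge> n + r" for k
      using that z(3) by (intro r(2) z(1) assms) auto
  qed
qed

section \<open>Irreducible shifts of finite type\<close>

text \<open>The windows of points of an SFT serve as the vertices of its graph presentation, a point
  being a bi-infinite walk.\<close>

definition window :: "nat \<Rightarrow> (int \<Rightarrow> 'a) \<Rightarrow> int \<Rightarrow> 'a list" where
  "window L x n = map (\<lambda>k. x (n + int k)) [0..<L]"

lemma window_eq_iff:
  "window L x m = window L y n \<longleftrightarrow> (\<forall>k\<in>{0..<int L}. x (m + k) = y (n + k))"
proof -
  have "window L x m = window L y n \<longleftrightarrow> (\<forall>k<L. x (m + int k) = y (n + int k))"
    by (auto simp: window_def list_eq_iff_nth_eq)
  also have "\<dots> \<longleftrightarrow> (\<forall>k\<in>{0..<int L}. x (m + k) = y (n + k))"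
    by (auto, metis int_nat_eq nat_less_iff not_le zle_int)
  finally show ?thesis .
qed

lemma window_same_iff:
  "window L x n = window L y n \<longleftrightarrow> (\<forall>k\<in>{n..<n + int L}. x k = y k)"
  unfolding window_eq_iff
proof safe
  fix k assume *: "\<forall>k\<in>{0..<int L}. x (n + k) = y (n + k)" "k \<in> {n..<n + int L}"
  then show "x k = y k" using bspec[OF *(1), of "k - n"] by auto
qed auto

lemma window_shift [simp]: "window L (shift s x) n = window L x (n - s)"
  by (simp add: window_eq_iff algebra_simps)

text \<open>\<open>in_of_windows\<close> is the form of finite type that gluing needs: membership is
  tested on windows of one length. \<open>connected\<close> is strong connectedness of the graph of
  windows; asking for \<open>m > 0\<close> provides loops of positive length, without which there is
  no period.\<close>

locale irreducible_sft =
  fixes A :: "'a set" and X :: "(int \<Rightarrow> 'a) set" and L :: nat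
  assumes subshift: "subshift A X"
    and in_of_windows: "(\<And>n. \<exists>z\<in>X. window L z n = window L x n) \<Longrightarrow> x \<in> X"
    and connected: "x \<in> X \<Longrightarrow> y \<in> X \<Longrightarrow>
      \<exists>m>0. \<exists>z\<in>X. window L z 0 = window L x 0 \<and> window L z (int m) = window L y 0"
begin

text \<open>Existence of a path of length \<open>m\<close> in the graph of windows, placed at the
  origin.\<close>

definition reach :: "nat \<Rightarrow> 'a list \<Rightarrow> 'a list \<Rightarrow> bool" where
  "reach m u v \<longleftrightarrow> (\<exists>z\<in>X. window L z 0 = u \<and> window L z (int m) = v)"

text \<open>The point followed may change at every time step. Since consecutive points agree on a
  whole window, \<open>G n\<close> agrees on its window at \<open>n\<close> with the diagonal
  configuration, which therefore has only allowed windows.\<close>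

lemma patch:
  assumes G: "\<And>n. G n \<in> X" and step: "\<And>n. window L (G n) (n + 1) = window L (G (n + 1)) (n + 1)"
  shows "(\<lambda>n. G n n) \<in> X"
proof (rule in_of_windows)
  fix n
  have "G n k = G (n + int j) k" if "n + int j \<le> k" "k < n + int L" for j k
    using that
  proof (induction j)
    case (Suc j)
    have "G (n + int j) k = G (n + int j + 1) k"
      using step[of "n + int j"] Suc.prems unfolding window_same_iff by auto
    then show ?case using Suc by (simp add: algebra_simps)
  qed simp
  \<comment> \<open>With \<open>j = k - n\<close> the claim compares \<open>G n\<close> and
    \<open>G k\<close> at position \<open>k\<close>.\<close>
  from this[of "nat (k - n)" k for k] have "window L (G n) n = window L (\<lambda>n. G n n) n"
    unfolding window_same_iff by auto
  then show "\<exists>z\<in>X. window L z n = window L (\<lambda>n. G n n) n" using G by blast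
qed

lemma splice:
  assumes "x \<in> X" "y \<in> X" "window L x n = window L y n"
  shows "(\<lambda>k. if k < n then x k else y k) \<in> X"
proof -
  have "(\<lambda>k. (if k < n then x else y) k) \<in> X"
  proof (rule patch[of "\<lambda>k. if k < n then x else y"])
    fix k
    consider "k + 1 < n" | "k + 1 = n" | "k \<ge> n" by linarith
    then show "window L (if k < n then x else y) (k + 1) =
        window L (if k + 1 < n then x else y) (k + 1)"
      using assms by cases auto
  qed (use assms in auto)
  moreover have "(\<lambda>k. (if k < n then x else y) k) = (\<lambda>k. if k < n then x k else y k)"
    by auto
  ultimately show ?thesis by simp
qed

text \<open>Two splices, at \<open>m\<close> and at \<open>n\<close>. The middle range extends to
  \<open>n + int L\<close> because \<open>z\<close> and \<open>y\<close> share the window at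
  \<open>n\<close>; \<open>reach_add\<close> relies on this when a path is shorter than a
  window.\<close>

lemma bi_asymptotic_of_windows:
  assumes x: "x \<in> X" and z: "z \<in> X" and y: "y \<in> X" and "m \<le> n"
    and xz: "window L z m = window L x m" and zy: "window L z n = window L y n"
  shows "\<exists>w\<in>X. (\<forall>k<m. w k = x k) \<and> (\<forall>k\<in>{m..<n + int L}. w k = z k) \<and> (\<forall>k\<ge>n. w k = y k)"
proof -
  let ?w = "\<lambda>k. if k < m then x k else z k"
  have w: "?w \<in> X" using splice[OF x z] xz by simp
  have "window L ?w n = window L y n" using zy \<open>m \<le> n\<close> unfolding window_same_iff by auto
  from splice[OF w y this] zy \<open>m \<le> n\<close> show ?thesis unfolding window_same_iff
    by (intro bexI[of _ "\<lambda>k. if k < n then ?w k else y k"]) auto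
qed

lemma reach_windowI:
  assumes "z \<in> X" "m \<le> n"
  shows "reach (nat (n - m)) (window L z m) (window L z n)"
  unfolding reach_def using assms subshift_shift[OF subshift]
  by (intro bexI[of _ "shift (-m) z"]) auto

lemma reach_window_iff:
  assumes "m \<le> n"
  shows "reach (nat (n - m)) (window L x m) (window L y n) \<longleftrightarrow>
    (\<exists>z\<in>X. window L z m = window L x m \<and> window L z n = window L y n)"
proof
  assume "reach (nat (n - m)) (window L x m) (window L y n)"
  then obtain z where "z \<in> X" "window L z 0 = window L x m" "window L z (n - m) = window L y n"
    unfolding reach_def using assms by auto
  then show "\<exists>z\<in>X. window L z m = window L x m \<and> window L z n = window L y n"
    using subshift_shift[OF subshift]
    by (intro bexI[of _ "shift m z"]) auto
next
  assume "\<exists>z\<in>X. window L z m = window L x m \<and> window L z n = window L y n"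
  then show "reach (nat (n - m)) (window L x m) (window L y n)"
    using reach_windowI[OF _ assms] by metis
qed

lemma reach_add:
  assumes "reach m u v" "reach n v w"
  shows "reach (m + n) u w"
proof -
  obtain x where x: "x \<in> X" "window L x 0 = u" "window L x (int m) = v"
    using assms(1) unfolding reach_def by blast
  obtain y where y: "y \<in> X" "window L y 0 = v" "window L y (int n) = w"
    using assms(2) unfolding reach_def by blast
  let ?y = "shift (int m) y"
  have y': "?y \<in> X" using y subshift_shift[OF subshift] by blast
  have "window L x (int m) = window L ?y (int m)" using x y by simp
  \<comment> \<open>Here \<open>x\<close> is both the left and the middle point, so the only change
    of point is the one at \<open>int m\<close>.\<close>
  from bi_asymptotic_of_windows[OF x(1) x(1) y' _ refl this, of 0]
  obtain z where z: "z \<in> X" "\<forall>k\<in>{0..<int m + int L}. z k = x k" "\<forall>k\<ge>int m. z k = ?y k"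
    by auto
  have "window L z 0 = window L x 0" using z unfolding window_same_iff by auto
  moreover have "window L z (int (m + n)) = window L ?y (int (m + n))"
    using z unfolding window_same_iff by auto
  ultimately show ?thesis unfolding reach_def using x y z(1) by auto
qed

section \<open>The period of an irreducible SFT and bridges of uniform length\<close>

lemma period_exists:
  obtains p N :: nat where "p > 0" "N > 0"
    "\<And>u v m n. reach m u v \<Longrightarrow> reach n u v \<Longrightarrow> m mod p = n mod p"
    "\<And>u v m n. reach m u v \<Longrightarrow> n \<ge> N \<Longrightarrow> n mod p = m mod p \<Longrightarrow> reach n u v"
proof (rule strongly_connected_period[of "(\<lambda>x. window L x 0) ` X" reach])
  have "(\<lambda>x. window L x 0) ` X \<subseteq> {xs. set xs \<subseteq> A \<and> length xs = L}"
    using subshift_in_alphabet[OF subshift] by (auto simp: window_def)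
  moreover have "finite {xs. set xs \<subseteq> A \<and> length xs = L}"
    using subshift by (intro finite_lists_length_eq) (simp add: subshift_def)
  ultimately show "finite ((\<lambda>x. window L x 0) ` X)" by (rule finite_subset)
  show "u \<in> (\<lambda>x. window L x 0) ` X \<and> v \<in> (\<lambda>x. window L x 0) ` X" if "reach m u v" for m u v
  proof -
    obtain z where z: "z \<in> X" "window L z 0 = u" "window L z (int m) = v"
      using \<open>reach m u v\<close> unfolding reach_def by blast
    then have "window L (shift (- int m) z) 0 = v" "shift (- int m) z \<in> X"
      using subshift_shift[OF subshift] by auto
    then show ?thesis using z by blast
  qed
  show "\<exists>m>0. reach m u v"
    if "u \<in> (\<lambda>x. window L x 0) ` X" "v \<in> (\<lambda>x. window L x 0) ` X" for u v
    using that connected unfolding reach_def by force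
qed (use reach_add in blast)+

lemma ex_reach_window:
  assumes "x \<in> X" "y \<in> X"
  shows "\<exists>t. reach t (window L x m) (window L y n)"
  using connected[of "shift (-m) x" "shift (-n) y"] subshift_shift[OF subshift] assms
  unfolding reach_def by auto

text \<open>All path lengths between two given windows lie in one class modulo the period, so it is
  enough to see that the class is that of \<open>N\<close>. Forward, the connecting point gives a
  path from far left on \<open>x\<close> to far right on \<open>y\<close> whose length is the
  difference of positions. Backward, going from \<open>x\<close> to \<open>y\<close> and returning
  to \<open>x\<close> is compared with following \<open>x\<close> itself. The bound \<open>N\<close>
  depends only on the subshift.\<close>

lemma bi_asymptotic_bridge:
  obtains N :: nat where "N > 0"
    "\<And>x y m. x \<in> X \<Longrightarrow> y \<in> X \<Longrightarrow> bi_asymptotic X x y \<Longrightarrow>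
       reach N (window L x m) (window L y (m + int N))"
    "\<And>x y m. x \<in> X \<Longrightarrow> y \<in> X \<Longrightarrow> bi_asymptotic X x y \<Longrightarrow>
       reach N (window L y m) (window L x (m + int N))"
proof -
  obtain p N :: nat where p: "p > 0" "N > 0"
    "\<And>u v m n. reach m u v \<Longrightarrow> reach n u v \<Longrightarrow> m mod p = n mod p"
    "\<And>u v m n. reach m u v \<Longrightarrow> n \<ge> N \<Longrightarrow> n mod p = m mod p \<Longrightarrow> reach n u v"
    using period_exists by blast
  have forward: "reach N (window L x m) (window L y (m + int N))"
    if xy: "x \<in> X" "y \<in> X" "bi_asymptotic X x y" for x y m
  proof -
    obtain z a b where z: "z \<in> X" "\<forall>k\<le>a. z k = x k" "\<forall>k\<ge>b. z k = y k"
      using xy(3) unfolding bi_asymptotic_def by blast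
    \<comment> \<open>Far enough to the left that the whole window of \<open>z\<close> at
      \<open>a'\<close> lies in the tail shared with \<open>x\<close>.\<close>
    define a' where "a' = min (a - int L) m"
    define b' where "b' = max b (m + int N)"
    have ab: "a' \<le> m" "m + int N \<le> b'" "a' \<le> b'" by (auto simp: a'_def b'_def)
    have "window L z a' = window L x a'" using z(2) by (auto simp: window_same_iff a'_def)
    moreover have "window L z b' = window L y b'" using z(3) by (auto simp: window_same_iff b'_def)
    ultimately have long: "reach (nat (b' - a')) (window L x a') (window L y b')"
      using reach_windowI[OF z(1) ab(3)] by simp
    obtain t where t: "reach t (window L x m) (window L y (m + int N))"
      using ex_reach_window xy by blast
    \<comment> \<open>The detour: along \<open>x\<close> up to \<open>m\<close>, across in
      \<open>t\<close> steps, then along \<open>y\<close>. Compared with \<open>long\<close>, it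
      forces \<open>t\<close> to be congruent to \<open>N\<close>.\<close>
    have "reach (nat (m - a') + t + nat (b' - (m + int N))) (window L x a') (window L y b')"
      by (intro reach_add[OF reach_add[OF reach_windowI t] reach_windowI] xy ab)
    from p(3)[OF this long]
    have "(nat (m - a') + t + nat (b' - (m + int N))) mod p = nat (b' - a') mod p" .
    also have "nat (b' - a') = nat (m - a') + N + nat (b' - (m + int N))" using ab by simp
    finally have "t mod p = N mod p" by (simp only: mod_add_cancel_nat)
    then show ?thesis using p(4)[OF t] by simp
  qed
  have backward: "reach N (window L y m) (window L x (m + int N))"
    if xy: "x \<in> X" "y \<in> X" "bi_asymptotic X x y" for x y m
  proof -
    obtain t where t: "reach t (window L y m) (window L x (m + int N))"
      using ex_reach_window xy by blast
    have "reach N (window L x (m - int N)) (window L y m)"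
      using forward[OF xy, of "m - int N"] by simp
    from reach_add[OF this t] have 1: "reach (N + t) (window L x (m - int N)) (window L x (m + int N))" .
    have 2: "reach (N + N) (window L x (m - int N)) (window L x (m + int N))"
    proof -
      have "nat ((m + int N) - (m - int N)) = N + N" by linarith
      then show ?thesis using reach_windowI[OF xy(1), of "m - int N" "m + int N"] by simp
    qed
    have "t mod p = N mod p" using mod_add_cancel_nat[of N t 0 p N] p(3)[OF 1 2] by simp
    then show ?thesis using p(4)[OF t] by simp
  qed
  show thesis using that[OF p(2) forward backward] by blast
qed

text \<open>The path length equals the distance of the two positions, so this is equality of phases.
  From a path one gets a connecting point by splicing on the left tail of \<open>x\<close> and the
  right tail of \<open>y\<close>.\<close>

lemma bi_asymptotic_iff_reach:
  assumes "x \<in> X" "y \<in> X"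
  shows "bi_asymptotic X x y \<longleftrightarrow> (\<exists>m n. reach n (window L x m) (window L y (m + int n)))"
proof
  assume "bi_asymptotic X x y"
  then show "\<exists>m n. reach n (window L x m) (window L y (m + int n))"
    using bi_asymptotic_bridge assms by metis
next
  assume "\<exists>m n. reach n (window L x m) (window L y (m + int n))"
  then obtain m n where "reach n (window L x m) (window L y (m + int n))" by blast
  then obtain z where z: "z \<in> X" "window L z m = window L x m"
    "window L z (m + int n) = window L y (m + int n)"
    using reach_window_iff[of m "m + int n" x y] by auto
  obtain w where "w \<in> X" "\<forall>k<m. w k = x k" "\<forall>k\<ge>m + int n. w k = y k"
    using bi_asymptotic_of_windows[OF assms(1) z(1) assms(2) _ z(2,3)] by auto
  then show "bi_asymptotic X x y"
    by (intro bi_asymptoticI[of w X "m - 1" x "m + int n"]) auto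
qed

lemma bi_asymptotic_sym:
  assumes "x \<in> X" "y \<in> X" "bi_asymptotic X x y"
  shows "bi_asymptotic X y x"
  using bi_asymptotic_bridge bi_asymptotic_iff_reach assms by metis

lemma bi_asymptotic_trans:
  assumes "x \<in> X" "y \<in> X" "z \<in> X" "bi_asymptotic X x y" "bi_asymptotic X y z"
  shows "bi_asymptotic X x z"
proof -
  obtain N where N: "\<And>x y m. x \<in> X \<Longrightarrow> y \<in> X \<Longrightarrow> bi_asymptotic X x y \<Longrightarrow>
       reach N (window L x m) (window L y (m + int N))"
    by (rule bi_asymptotic_bridge) blast
  have "reach (N + N) (window L x 0) (window L z (0 + int (N + N)))"
    using reach_add N[OF assms(1,2,4), of 0] N[OF assms(2,3,5), of "int N"] by simp
  then show ?thesis using bi_asymptotic_iff_reach assms by blast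
qed

text \<open>Some path leads from the window of \<open>x\<close> at 0 to that of \<open>y\<close> at
  0; shifting \<open>y\<close> by the length of this path puts its end at the right
  position.\<close>

lemma ex_bi_asymptotic_shift:
  assumes "x \<in> X" "y \<in> X"
  shows "\<exists>k. bi_asymptotic X x (shift k y)"
proof -
  obtain m where "reach m (window L x 0) (window L y 0)" using ex_reach_window assms by blast
  then have "reach m (window L x 0) (window L (shift (int m) y) (0 + int m))" by simp
  then show ?thesis using bi_asymptotic_iff_reach assms subshift_shift[OF subshift] by blast
qed

end

section \<open>Transitive SFTs as instances of the locale\<close>

lemma sft_irreducible:
  assumes "sft A X" "transitive_subshift X"
  obtains L where "irreducible_sft A X L"
proof -
  have X: "subshift A X" using assms(1) by (simp add: sft_def)
  obtain F where F: "finite F"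
    "X = {x \<in> topspace (shift_topology A). \<forall>w\<in>F. \<not> appears_in w x}"
    using assms(1) unfolding sft_def finite_type_def by blast
  \<comment> \<open>Longer than every forbidden word, so an occurrence at \<open>i\<close> is
    visible in the window at \<open>i\<close>; positive even if \<open>F\<close> is empty, so that
    windows also see single letters.\<close>
  define L where "L = Suc (Max (insert 0 (length ` F)))"
  have "L > 0" by (simp add: L_def)
  have L: "length w < L" if "w \<in> F" for w
    using F(1) that unfolding L_def by (simp add: less_Suc_eq_le)
  have "irreducible_sft A X L"
  proof
    show "subshift A X" by fact
    fix x assume x: "\<And>n. \<exists>z\<in>X. window L z n = window L x n"
    have "x n \<in> A" for n
    proof -
      obtain z where z: "z \<in> X" "window L z n = window L x n" using x by blast
      then have "z n = x n" unfolding window_same_iff by (simp add: L_def)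
      then show ?thesis using subshift_in_alphabet[OF X z(1), of n] by simp
    qed
    moreover have "\<not> appears_in w x" if w: "w \<in> F" for w
    proof
      assume "appears_in w x"
      then obtain i where i: "\<forall>k<length w. x (i + int k) = w ! k"
        unfolding appears_in_def by blast
      obtain z where z: "z \<in> X" "window L z i = window L x i" using x by blast
      then have "\<forall>k<length w. z (i + int k) = w ! k"
        using i L[OF w] unfolding window_same_iff by simp
      then have "appears_in w z" unfolding appears_in_def by blast
      then show False using z(1) w F(2) by blast
    qed
    ultimately show "x \<in> X" unfolding F(2) by (simp add: topspace_shift_topology)
  next
    fix x y assume xy: "x \<in> X" "y \<in> X"
    have "window L z 0 \<in> language X" if "z \<in> X" for z
      unfolding language_def appears_in_def using that
      by (auto simp: window_def intro!: bexI[of _ z] exI[of _ 0])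
    then obtain w where "window L x 0 @ w @ window L y 0 \<in> language X"
      using assms(2) xy unfolding transitive_subshift_def by blast
    then obtain z i where z: "z \<in> X"
      "\<forall>k<length (window L x 0 @ w @ window L y 0).
         z (i + int k) = (window L x 0 @ w @ window L y 0) ! k"
      unfolding language_def appears_in_def by blast
    have len: "length (window L x 0) = L" for x :: "int \<Rightarrow> 'a" by (simp add: window_def)
    \<comment> \<open>The occurrence found at \<open>i\<close> is moved to the origin; the second
      window starts after the first one and the connecting word.\<close>
    let ?z = "shift (- i) z" and ?m = "L + length w"
    have "window L ?z 0 = window L x 0"
    proof (rule nth_equalityI)
      fix k assume "k < length (window L ?z 0)"
      then have "k < L" by (simp add: window_def)
      then show "window L ?z 0 ! k = window L x 0 ! k"
        using z(2)[rule_format, of k] by (simp add: len nth_append window_def add.commute)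
    qed (simp add: window_def)
    moreover have "window L ?z (int ?m) = window L y 0"
    proof (rule nth_equalityI)
      fix k assume "k < length (window L ?z (int ?m))"
      then have "k < L" by (simp add: window_def)
      then show "window L ?z (int ?m) ! k = window L y 0 ! k"
        using z(2)[rule_format, of "?m + k"] by (simp add: len nth_append window_def algebra_simps)
    qed (simp add: window_def)
    ultimately show "\<exists>m>0. \<exists>z\<in>X. window L z 0 = window L x 0 \<and> window L z (int m) = window L y 0"
      using subshift_shift[OF X z(1)] \<open>L > 0\<close> by (metis add_gr_0)
  qed
  then show thesis by (rule that)
qed

section \<open>Interpolating between two configurations\<close>

text \<open>Position \<open>n\<close> lies in the entry zone \<open>{a..<a + N}\<close> of a run of
  ones starting at \<open>a\<close>. Asking for \<open>2 * N\<close> ones keeps this zone disjoint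
  from the exit zone of the same run, described by \<open>falling\<close>.\<close>

definition rising :: "int \<Rightarrow> (int \<Rightarrow> nat) \<Rightarrow> int \<Rightarrow> int \<Rightarrow> bool" where
  "rising N i n a \<longleftrightarrow> n - N < a \<and> a \<le> n \<and> i (a - 1) = 0 \<and> (\<forall>k\<in>{a..<a + 2 * N}. i k = 1)"

definition falling :: "int \<Rightarrow> (int \<Rightarrow> nat) \<Rightarrow> int \<Rightarrow> int \<Rightarrow> bool" where
  "falling N i n b \<longleftrightarrow> n < b \<and> b \<le> n + N \<and> i b = 0 \<and> (\<forall>k\<in>{b - 2 * N..<b}. i k = 1)"

text \<open>Two candidates are less than \<open>N\<close> apart, so the zero in front of the later
  one would fall into the run of the earlier one.\<close>

lemma rising_unique: "rising N i n a \<Longrightarrow> rising N i n a' \<Longrightarrow> a = a'"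
proof (induction a a' rule: linorder_wlog)
  case (le a a')
  show ?case
  proof (rule ccontr)
    assume "a \<noteq> a'"
    then have "a' - 1 \<in> {a..<a + 2 * N}" using le by (auto simp: rising_def)
    then have "i (a' - 1) = 1" using le unfolding rising_def by blast
    then show False using le by (simp add: rising_def)
  qed
qed auto

lemma falling_unique: "falling N i n b \<Longrightarrow> falling N i n b' \<Longrightarrow> b = b'"
proof (induction b b' rule: linorder_wlog)
  case (le b b')
  show ?case
  proof (rule ccontr)
    assume "b \<noteq> b'"
    then have "b \<in> {b' - 2 * N..<b'}" using le by (auto simp: falling_def)
    then have "i b = 1" using le unfolding falling_def by blast
    then show False using le by (simp add: falling_def)
  qed
qed auto

lemma ball_atLeastLessThan_shift:
  fixes a b s :: int
  shows "(\<forall>k\<in>{a..<b}. P (k - s)) \<longleftrightarrow> (\<forall>k\<in>{a - s..<b - s}. P k)"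
proof safe
  fix k assume *: "\<forall>k\<in>{a..<b}. P (k - s)" "k \<in> {a - s..<b - s}"
  then show "P k" using bspec[OF *(1), of "k + s"] by auto
qed auto

lemma rising_shift: "rising N (shift s i) n a \<longleftrightarrow> rising N i (n - s) (a - s)"
  using ball_atLeastLessThan_shift[of a "a + 2 * N" "\<lambda>k. i k = 1" s]
  by (auto simp: rising_def algebra_simps)

lemma falling_shift: "falling N (shift s i) n b \<longleftrightarrow> falling N i (n - s) (b - s)"
  using ball_atLeastLessThan_shift[of "b - 2 * N" b "\<lambda>k. i k = 1" s]
  by (auto simp: falling_def algebra_simps)

text \<open>An entry zone that does not already contain \<open>n\<close> begins exactly at
  \<open>n + 1\<close>; the next lemma is the analogue for exit zones. These facts limit the
  transitions in \<open>guide_step\<close>.\<close>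

lemma rising_next: "rising N i (n + 1) a \<Longrightarrow> a = n + 1 \<or> rising N i n a"
  by (auto simp: rising_def)

lemma falling_next: "falling N i (n + 1) b \<Longrightarrow> b = n + 1 + N \<or> falling N i n b"
  by (auto simp: falling_def)

lemma rising_ones: "rising N i n a \<Longrightarrow> n \<le> k \<Longrightarrow> k \<le> n + N \<Longrightarrow> i k = 1"
  by (auto simp: rising_def)

lemma falling_ones: "falling N i n b \<Longrightarrow> n - N \<le> k \<Longrightarrow> k \<le> n \<Longrightarrow> i k = 1"
  by (auto simp: falling_def)

context irreducible_sft
begin

text \<open>The choice depends on the length and the two words only, and is made at the origin. A
  bridge placed elsewhere is a shifted copy, which keeps the construction local and
  shift-commuting.\<close>

definition bridge :: "int \<Rightarrow> 'a list \<Rightarrow> 'a list \<Rightarrow> int \<Rightarrow> 'a" where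
  "bridge N u v = (SOME z. z \<in> X \<and> window L z 0 = u \<and> window L z N = v)"

lemma bridge:
  assumes "reach N u v"
  shows "bridge (int N) u v \<in> X" "window L (bridge (int N) u v) 0 = u"
    "window L (bridge (int N) u v) (int N) = v"
proof -
  have "\<exists>z. z \<in> X \<and> window L z 0 = u \<and> window L z (int N) = v"
    using assms unfolding reach_def by blast
  from someI_ex[OF this] show "bridge (int N) u v \<in> X" "window L (bridge (int N) u v) 0 = u"
    "window L (bridge (int N) u v) (int N) = v"
    unfolding bridge_def by blast+
qed

text \<open>
  The point followed at time \<open>n\<close>: it is \<open>y\<close> inside the long runs of ones of \<open>i\<close> and \<open>x\<close> outside
  of them, and the first and last \<open>N\<close> positions of such a run are spent on a bridge.
\<close>

definition guide :: "int \<Rightarrow> (int \<Rightarrow> nat) \<Rightarrow> (int \<Rightarrow> 'a) \<Rightarrow> (int \<Rightarrow> 'a) \<Rightarrow> int \<Rightarrow> int \<Rightarrow> 'a" where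
  "guide N i x y n =
     (if \<exists>a. rising N i n a then
        let a = THE a. rising N i n a
        in shift a (bridge N (window L x a) (window L y (a + N)))
      else if \<exists>b. falling N i n b then
        let b = THE b. falling N i n b
        in shift (b - N) (bridge N (window L y (b - N)) (window L x b))
      else if \<forall>k\<in>{n - N..<n + N}. i k = 1 then y else x)"

lemma guide_rising:
  assumes "rising N i n a"
  shows "guide N i x y n = shift a (bridge N (window L x a) (window L y (a + N)))"
proof -
  have "(THE a. rising N i n a) = a" using assms rising_unique by blast
  then show ?thesis using assms unfolding guide_def Let_def by auto
qed

lemma guide_falling:
  assumes "falling N i n b" "\<nexists>a. rising N i n a"
  shows "guide N i x y n = shift (b - N) (bridge N (window L y (b - N)) (window L x b))"
proof -
  have "(THE b. falling N i n b) = b" using assms falling_unique by blast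
  then show ?thesis using assms unfolding guide_def Let_def by auto
qed

lemma guide_constant:
  assumes "\<nexists>a. rising N i n a" "\<nexists>b. falling N i n b"
  shows "guide N i x y n = (if \<forall>k\<in>{n - N..<n + N}. i k = 1 then y else x)"
  unfolding guide_def if_not_P[OF assms(1)] if_not_P[OF assms(2)] by (rule refl)

lemma guide_y:
  assumes "\<nexists>a. rising N i n a" "\<nexists>b. falling N i n b" "\<forall>k\<in>{n - N..<n + N}. i k = 1"
  shows "guide N i x y n = y"
  unfolding guide_constant[OF assms(1,2)] by (rule if_P[OF assms(3)])

lemma guide_x:
  assumes "\<nexists>a. rising N i n a" "\<nexists>b. falling N i n b" "\<not> (\<forall>k\<in>{n - N..<n + N}. i k = 1)"
  shows "guide N i x y n = x"
  unfolding guide_constant[OF assms(1,2)] by (rule if_not_P[OF assms(3)])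

lemma guide_shift:
  "guide N (shift s i) (shift s x) (shift s y) n = shift s (guide N i x y (n - s))"
proof -
  consider (up) a where "rising N i (n - s) a"
    | (down) b where "falling N i (n - s) b" "\<nexists>a. rising N i (n - s) a"
    | (const) "\<nexists>a. rising N i (n - s) a" "\<nexists>b. falling N i (n - s) b"
    by blast
  then show ?thesis
  proof cases
    case up
    then have "rising N (shift s i) n (a + s)" by (simp add: rising_shift)
    from guide_rising[OF this] guide_rising[OF up] show ?thesis
      by (simp add: algebra_simps)
  next
    case down
    then have "falling N (shift s i) n (b + s)" "\<nexists>a. rising N (shift s i) n a"
      by (simp_all add: falling_shift rising_shift)
    from guide_falling[OF this] guide_falling[OF down] show ?thesis
      by (simp add: algebra_simps)
  next
    case const
    have "(\<forall>k\<in>{n - N..<n + N}. i (k - s) = 1) \<longleftrightarrow> (\<forall>k\<in>{n - s - N..<n - s + N}. i k = 1)"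
      using ball_atLeastLessThan_shift[of "n - N" "n + N" "\<lambda>k. i k = 1" s]
      by (simp add: algebra_simps)
    moreover have "\<nexists>a. rising N (shift s i) n a" "\<nexists>b. falling N (shift s i) n b"
      using const by (simp_all add: falling_shift rising_shift)
    ultimately show ?thesis using guide_constant[of N "shift s i" n] guide_constant[OF const]
      by simp
  qed
qed

text \<open>The tests read \<open>i\<close> within distance \<open>2 * N\<close> of
  \<open>n\<close>, and the bridges read windows starting within distance \<open>N\<close> of
  \<open>n\<close>, so the radii are sufficient.\<close>

lemma guide_local:
  assumes "N > 0"
    and i: "\<And>k. \<bar>k - n\<bar> \<le> 3 * N \<Longrightarrow> i k = i' k"
    and x: "\<And>k. \<bar>k - n\<bar> \<le> 3 * N + int L \<Longrightarrow> x k = x' k"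
    and y: "\<And>k. \<bar>k - n\<bar> \<le> 3 * N + int L \<Longrightarrow> y k = y' k"
  shows "guide N i x y n n = guide N i' x' y' n n"
proof -
  have rising: "rising N i n a \<longleftrightarrow> rising N i' n a" for a
    unfolding rising_def using i \<open>N > 0\<close> by (intro conj_cong refl ball_cong) auto
  have falling: "falling N i n b \<longleftrightarrow> falling N i' n b" for b
    unfolding falling_def using i \<open>N > 0\<close> by (intro conj_cong refl ball_cong) auto
  have xw: "window L x m = window L x' m" if "\<bar>m - n\<bar> \<le> 3 * N" for m
    unfolding window_same_iff using that by (auto intro!: x)
  have yw: "window L y m = window L y' m" if "\<bar>m - n\<bar> \<le> 3 * N" for m
    unfolding window_same_iff using that by (auto intro!: y)
  consider (up) a where "rising N i n a"
    | (down) b where "falling N i n b" "\<nexists>a. rising N i n a"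
    | (const) "\<nexists>a. rising N i n a" "\<nexists>b. falling N i n b"
    by blast
  then show ?thesis
  proof cases
    case up
    then have "window L x a = window L x' a" "window L y (a + N) = window L y' (a + N)"
      using \<open>N > 0\<close> by (auto simp: rising_def intro!: xw yw)
    then show ?thesis using up guide_rising rising by simp
  next
    case down
    then have "window L x b = window L x' b" "window L y (b - N) = window L y' (b - N)"
      using \<open>N > 0\<close> by (auto simp: falling_def intro!: xw yw)
    then show ?thesis using down guide_falling rising falling by simp
  next
    case const
    have "(\<forall>k\<in>{n - N..<n + N}. i k = 1) \<longleftrightarrow> (\<forall>k\<in>{n - N..<n + N}. i' k = 1)"
      using \<open>N > 0\<close> i by (intro ball_cong refl) auto
    moreover have "x n = x' n" "y n = y' n" using \<open>N > 0\<close> by (auto intro!: x y)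
    ultimately show ?thesis using const guide_constant rising falling by simp
  qed
qed

lemma guide_in:
  fixes N :: nat
  assumes xy: "x \<in> X" "y \<in> X"
    and up: "\<And>m. reach N (window L x m) (window L y (m + int N))"
    and down: "\<And>m. reach N (window L y m) (window L x (m + int N))"
  shows "guide (int N) i x y n \<in> X"
proof -
  have b: "shift k (bridge (int N) (window L x m) (window L y (m + int N))) \<in> X"
    "shift k (bridge (int N) (window L y (m - int N)) (window L x m)) \<in> X" for k m
    using bridge(1)[OF up] bridge(1)[OF down, of "m - int N"] subshift_shift[OF subshift] by simp_all
  consider (up) a where "rising N i n a"
    | (down) b where "falling N i n b" "\<nexists>a. rising N i n a"
    | (const) "\<nexists>a. rising N i n a" "\<nexists>b. falling N i n b"
    by blast
  then show ?thesis
    using b xy by cases (simp_all add: guide_rising guide_falling guide_constant)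
qed

text \<open>This is the hypothesis of \<open>patch\<close>. The guide changes only where a zone
  begins or ends, and there the end windows of the bridges are those of \<open>x\<close> or
  \<open>y\<close>. The transitions are \<open>x\<close> to entry bridge, entry bridge to
  \<open>y\<close>, \<open>y\<close> to exit bridge, exit bridge to \<open>x\<close>, and entry
  bridge directly to exit bridge.\<close>

lemma guide_step:
  fixes N :: nat and i :: "int \<Rightarrow> nat"
  assumes N: "N > 0" and i01: "\<And>k. i k = 0 \<or> i k = 1"
    and up: "\<And>m. reach N (window L x m) (window L y (m + int N))"
    and down: "\<And>m. reach N (window L y m) (window L x (m + int N))"
  shows "window L (guide (int N) i x y n) (n + 1) = window L (guide (int N) i x y (n + 1)) (n + 1)"
proof -
  let ?N = "int N"
  let ?G = "guide ?N i x y"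
  have ones: False if "i k = 0" "\<forall>k\<in>{a..<b}. i k = 1" "a \<le> k" "k < b" for k a b
    using that by auto
  have up0: "window L (?G m) a = window L x a" and upN: "window L (?G m) (a + ?N) = window L y (a + ?N)"
    if "rising ?N i m a" for m a
    using guide_rising[OF that] bridge(2,3)[OF up, of a] by simp_all
  have down0: "window L (?G m) (b - ?N) = window L y (b - ?N)" and downN: "window L (?G m) b = window L x b"
    if "falling ?N i m b" "\<nexists>a. rising ?N i m a" for m b
    using guide_falling[OF that] bridge(2,3)[OF down, of "b - ?N"] by simp_all
  consider (up) a where "rising ?N i n a"
    | (down) b where "falling ?N i n b" "\<nexists>a. rising ?N i n a"
    | (one) "\<nexists>a. rising ?N i n a" "\<nexists>b. falling ?N i n b" "\<forall>k\<in>{n - ?N..<n + ?N}. i k = 1"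
    | (zero) "\<nexists>a. rising ?N i n a" "\<nexists>b. falling ?N i n b" "\<not> (\<forall>k\<in>{n - ?N..<n + ?N}. i k = 1)"
    by blast
  then show ?thesis
  proof cases
    case up
    show ?thesis
    proof (cases "n + 1 - ?N < a")
      case True
      then have "rising ?N i (n + 1) a" using up by (simp add: rising_def)
      then show ?thesis using guide_rising up by metis
    next
      case False
      then have a: "a + ?N = n + 1" using up by (simp add: rising_def)
      have run: "\<forall>k\<in>{n + 1 - ?N..<n + 1 + ?N}. i k = 1" using up a by (auto simp: rising_def)
      have nr: "\<nexists>a. rising ?N i (n + 1) a"
      proof
        assume "\<exists>a. rising ?N i (n + 1) a"
        then obtain a' where "rising ?N i (n + 1) a'" by blast
        then show False using ones[OF _ run, of "a' - 1"] N by (simp add: rising_def)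
      qed
      have "window L (?G (n + 1)) (n + 1) = window L y (n + 1)"
      \<comment> \<open>If the run has exactly \<open>2 * ?N\<close> ones, the exit bridge begins at
        \<open>n + 1\<close>, where the entry bridge ends; it too shows the window of
        \<open>y\<close> there.\<close>
      proof (cases "\<exists>b. falling ?N i (n + 1) b")
        case True
        then obtain b where b: "falling ?N i (n + 1) b" by blast
        then have "b = n + 1 + ?N" using ones[OF _ run, of b] by (force simp: falling_def)
        then show ?thesis using down0[OF b nr] by simp
      next
        case False
        then show ?thesis using guide_y[OF nr False run] by simp
      qed
      then show ?thesis using upN[OF up] a by simp
    qed
  next
    case down
    have b: "n < b" "b \<le> n + ?N" "i b = 0" "\<forall>k\<in>{b - 2 * ?N..<b}. i k = 1"
      using down(1) by (auto simp: falling_def)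
    show ?thesis
    proof (cases "n + 1 < b")
      case True
      have "\<nexists>a. rising ?N i (n + 1) a"
      proof
        assume "\<exists>a. rising ?N i (n + 1) a"
        then obtain a where a: "rising ?N i (n + 1) a" by blast
        then have "a = n + 1" using down(2) rising_next by blast
        then have "i n = 0" using a by (simp add: rising_def)
        then show False using ones[OF _ b(4), of n] b(1,2) N by simp
      qed
      moreover have "falling ?N i (n + 1) b" using down(1) True by (simp add: falling_def)
      ultimately show ?thesis using guide_falling down by metis
    next
      case False
      then have b1: "b = n + 1" using b(1) by simp
      then have i1: "i (n + 1) = 0" using b(3) by simp
      have "\<nexists>a. rising ?N i (n + 1) a"
        using rising_ones[of ?N i "n + 1" _ "n + 1"] i1 by fastforce
      moreover have "\<nexists>b. falling ?N i (n + 1) b"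
        using falling_ones[of ?N i "n + 1" _ "n + 1"] i1 by fastforce
      moreover have "\<not> (\<forall>k\<in>{n + 1 - ?N..<n + 1 + ?N}. i k = 1)"
        using ones[OF i1, of "n + 1 - ?N" "n + 1 + ?N"] N by auto
      ultimately have "?G (n + 1) = x" by (rule guide_x)
      then show ?thesis using downN[OF down] b1 by simp
    qed
  next
    case one
    then have Gn: "?G n = y" by (rule guide_y)
    have nr: "\<nexists>a. rising ?N i (n + 1) a"
    proof
      assume "\<exists>a. rising ?N i (n + 1) a"
      then obtain a where a: "rising ?N i (n + 1) a" by blast
      then have "a = n + 1" using one(1) rising_next by blast
      then have "i n = 0" using a by (simp add: rising_def)
      then show False using ones[OF _ one(3), of n] N by simp
    qed
    show ?thesis
    proof (cases "\<exists>b. falling ?N i (n + 1) b")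
      case True
      then obtain b where b: "falling ?N i (n + 1) b" by blast
      then have "b = n + 1 + ?N" using one(2) falling_next by blast
      then show ?thesis using down0[OF b nr] Gn by simp
    next
      case False
      \<comment> \<open>A zero at \<open>n + ?N\<close> would end a block of \<open>2 * ?N\<close>
        ones and put \<open>n\<close> into an exit zone. So the surrounding block of ones moves
        along with \<open>n\<close>.\<close>
      have "i (n + ?N) \<noteq> 0"
      proof
        assume "i (n + ?N) = 0"
        then have "falling ?N i n (n + ?N)" using one(3) N by (simp add: falling_def)
        then show False using one(2) by blast
      qed
      then have "i (n + ?N) = 1" using i01[of "n + ?N"] by simp
      then have "\<forall>k\<in>{n + 1 - ?N..<n + 1 + ?N}. i k = 1"
        using one(3) by (smt (verit) atLeastLessThan_iff)
      then show ?thesis using guide_y[OF nr False] Gn by simp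
    qed
  next
    case zero
    then have Gn: "?G n = x" by (rule guide_x)
    \<comment> \<open>If the block became full only now, there would be a zero at
      \<open>n - ?N\<close> followed by \<open>2 * ?N\<close> ones, and \<open>n\<close> would
      already be in an entry zone.\<close>
    have no: "\<not> (\<forall>k\<in>{n + 1 - ?N..<n + 1 + ?N}. i k = 1)"
    proof
      assume run: "\<forall>k\<in>{n + 1 - ?N..<n + 1 + ?N}. i k = 1"
      have "i (n - ?N) \<noteq> 1" using zero(3) run by (smt (verit) atLeastLessThan_iff)
      then have "i (n - ?N) = 0" using i01[of "n - ?N"] by simp
      then have "rising ?N i n (n + 1 - ?N)" using run N by (simp add: rising_def)
      then show False using zero(1) by blast
    qed
    show ?thesis
    proof (cases "\<exists>a. rising ?N i (n + 1) a")
      case True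
      then obtain a where a: "rising ?N i (n + 1) a" by blast
      then have "a = n + 1" using zero(1) rising_next by blast
      then show ?thesis using up0[OF a] Gn by simp
    next
      case nr: False
      have "\<nexists>b. falling ?N i (n + 1) b"
      proof
        assume "\<exists>b. falling ?N i (n + 1) b"
        then obtain b where b: "falling ?N i (n + 1) b" by blast
        then have "b = n + 1 + ?N" using zero(2) falling_next by blast
        then have "\<forall>k\<in>{n + 1 - ?N..<n + 1 + ?N}. i k = 1"
          using b by (simp add: falling_def)
        then show False using no by blast
      qed
      then show ?thesis using guide_x[OF nr _ no] Gn by simp
    qed
  qed
qed

lemma guide_zero:
  assumes "N > 0"
  shows "guide N (\<lambda>_. 0) x y n = x"
proof -
  have "\<nexists>a. rising N (\<lambda>_. 0) n a" "\<nexists>b. falling N (\<lambda>_. 0) n b"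
    using rising_ones[of N "\<lambda>_. 0" n _ n] falling_ones[of N "\<lambda>_. 0" n _ n] assms by auto
  from guide_constant[OF this] show ?thesis using assms by auto
qed

lemma guide_one: "guide N (\<lambda>_. 1) x y n = y"
proof -
  have "\<nexists>a. rising N (\<lambda>_. 1) n a" "\<nexists>b. falling N (\<lambda>_. 1) n b"
    by (auto simp: rising_def falling_def)
  from guide_constant[OF this] show ?thesis by simp
qed

section \<open>Homotopies between pointwise bi-asymptotic block maps\<close>

text \<open>The homotopy is the diagonal of the guide between \<open>f z\<close> and
  \<open>g z\<close>. One bridge length serves all \<open>z\<close>, so its coordinates depend on
  bounded windows; \<open>patch\<close> puts its values in \<open>X\<close>, and
  \<open>guide_shift\<close> gives equivariance.\<close>

lemma homotopic_of_bi_asymptotic: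
  assumes Z: "subshift C Z" and f: "block_map C Z A X f" and g: "block_map C Z A X g"
    and asymp: "\<And>z. z \<in> Z \<Longrightarrow> bi_asymptotic X (f z) (g z)"
  shows "homotopic_block_maps C Z A X f g"
proof -
  obtain N :: nat where N: "N > 0"
    and up: "\<And>x y m. x \<in> X \<Longrightarrow> y \<in> X \<Longrightarrow> bi_asymptotic X x y \<Longrightarrow>
       reach N (window L x m) (window L y (m + int N))"
    and down: "\<And>x y m. x \<in> X \<Longrightarrow> y \<in> X \<Longrightarrow> bi_asymptotic X x y \<Longrightarrow>
       reach N (window L y m) (window L x (m + int N))"
    by (rule bi_asymptotic_bridge) blast
  let ?S = "prod_topology interval_topology (subshift_topology C Z)"
  define h where "h p = (\<lambda>n. guide (int N) (fst p) (f (snd p)) (g (snd p)) n n)"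
    for p :: "(int \<Rightarrow> nat) \<times> (int \<Rightarrow> 'b)"
  have S: "topspace ?S = {i. \<forall>n. i n = 0 \<or> i n = 1} \<times> Z"
    using topspace_subshift[OF Z] by (simp add: interval_topology_def topspace_shift_topology)
  note f_in = block_map_in[OF f Z] and g_in = block_map_in[OF g Z]
  have h_in: "h p \<in> X" if "p \<in> topspace ?S" for p
  proof -
    have z: "snd p \<in> Z" and i: "\<And>n. fst p n = 0 \<or> fst p n = 1" using that S by auto
    note br = up[OF f_in[OF z] g_in[OF z] asymp[OF z]] down[OF f_in[OF z] g_in[OF z] asymp[OF z]]
    show ?thesis unfolding h_def
      by (rule patch[of "guide (int N) (fst p) (f (snd p)) (g (snd p))"])
         (use guide_in[OF f_in[OF z] g_in[OF z] br] guide_step[OF N i br] in auto)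
  qed
  have fst: "continuous_map ?S (shift_topology {0, 1}) fst"
    using continuous_map_fst unfolding interval_topology_def by blast
  have snd: "continuous_map ?S (shift_topology A) (\<lambda>p. k (snd p))" if "block_map C Z A X k" for k
    using continuous_map_compose[OF continuous_map_snd block_map_continuous[OF that]]
    by (simp add: o_def)
  have "continuous_map ?S (discrete_topology A) (\<lambda>p. h p n)" for n
  proof (rule continuous_map_discrete_local)
    fix p assume p: "p \<in> topspace ?S"
    show "h p n \<in> A" using subshift_in_alphabet[OF subshift h_in[OF p]] .
    \<comment> \<open>By \<open>guide_local\<close>, fixing the interval coordinate and both images
      on this window fixes \<open>h p n\<close>.\<close>
    let ?W = "{n - (3 * int N + int L)..n + (3 * int N + int L)}"
    obtain U1 where U1: "openin ?S U1" "p \<in> U1" "\<forall>q\<in>U1. \<forall>k\<in>?W. fst q k = fst p k"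
      using window_neighbourhood[OF fst p finite_atLeastAtMost_int] by meson
    obtain U2 where U2: "openin ?S U2" "p \<in> U2" "\<forall>q\<in>U2. \<forall>k\<in>?W. f (snd q) k = f (snd p) k"
      using window_neighbourhood[OF snd[OF f] p finite_atLeastAtMost_int] by meson
    obtain U3 where U3: "openin ?S U3" "p \<in> U3" "\<forall>q\<in>U3. \<forall>k\<in>?W. g (snd q) k = g (snd p) k"
      using window_neighbourhood[OF snd[OF g] p finite_atLeastAtMost_int] by meson
    have "h q n = h p n" if q: "q \<in> U1 \<inter> U2 \<inter> U3" for q
      unfolding h_def
    proof (rule guide_local)
      fix k assume "\<bar>k - n\<bar> \<le> 3 * int N"
      then have "k \<in> ?W" by auto
      then show "fst q k = fst p k" using U1(3) q by blast
    next
      fix k assume "\<bar>k - n\<bar> \<le> 3 * int N + int L"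
      then have k: "k \<in> ?W" by auto
      then show "f (snd q) k = f (snd p) k" using U2(3) q by blast
      show "g (snd q) k = g (snd p) k" using U3(3) q k by blast
    qed (use N in simp)
    then show "\<exists>U. openin ?S U \<and> p \<in> U \<and> (\<forall>q\<in>U. h q n = h p n)"
      using U1(1,2) U2(1,2) U3(1,2) by (intro exI[of _ "U1 \<inter> U2 \<inter> U3"]) blast
  qed
  then have "continuous_map ?S (subshift_topology A X) h"
    unfolding continuous_map_into_subshift_iff using h_in by blast
  moreover have "h (diagonal_shift n p) = shift n (h p)" if "p \<in> topspace ?S" for n p
  proof -
    have "snd p \<in> Z" using that S by auto
    then show ?thesis
      by (simp add: h_def diagonal_shift_def block_map_shift[OF f Z] block_map_shift[OF g Z]
          guide_shift fun_eq_iff)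
  qed
  ultimately have "equivariant_map ?S diagonal_shift (subshift_topology A X) shift h"
    unfolding equivariant_map_def by blast
  moreover have "h ((\<lambda>_. 0), z) = f z \<and> h ((\<lambda>_. 1), z) = g z" for z
    using N guide_zero[of "int N"] guide_one[of "int N"] by (simp add: h_def)
  ultimately show ?thesis unfolding homotopic_block_maps_def using f g by blast
qed

end

section \<open>From mutual block maps to homotopy equivalence\<close>

theorem theorem1p10:
  fixes A :: "'a set" and X :: "(int \<Rightarrow> 'a) set"
    and B :: "'b set" and Y :: "(int \<Rightarrow> 'b) set"
  assumes "sft A X" and "transitive_subshift X"
    and "sft B Y" and "transitive_subshift Y"
  shows "homotopy_equivalent_subshifts A X B Y \<longleftrightarrow>
         (\<exists>f. block_map A X B Y f) \<and> (\<exists>g. block_map B Y A X g)"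
proof
  assume "homotopy_equivalent_subshifts A X B Y"
  then show "(\<exists>f. block_map A X B Y f) \<and> (\<exists>g. block_map B Y A X g)"
    unfolding homotopy_equivalent_subshifts_def by blast
next
  assume "(\<exists>f. block_map A X B Y f) \<and> (\<exists>g. block_map B Y A X g)"
  then obtain f g0 where f: "block_map A X B Y f" and g0: "block_map B Y A X g0" by blast
  have X: "subshift A X" and Y: "subshift B Y" using assms by (simp_all add: sft_def)
  obtain L M where "irreducible_sft A X L" "irreducible_sft B Y M"
    using assms sft_irreducible by metis
  then interpret X: irreducible_sft A X L + Y: irreducible_sft B Y M
    by simp_all
  obtain k where k: "\<forall>x\<in>X. bi_asymptotic X x (shift k (g0 (f x)))"
  proof (cases "X = {}")
    case True
    then show thesis using that by blast
  next
    case False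
    then obtain x0 where x0: "x0 \<in> X" by blast
    have gf: "g0 (f x) \<in> X" if "x \<in> X" for x
      using block_map_in[OF g0 Y block_map_in[OF f X that]] .
    \<comment> \<open>The correcting shift is fixed at the single base point
      \<open>x0\<close>.\<close>
    obtain k where k: "bi_asymptotic X x0 (shift k (g0 (f x0)))"
      using X.ex_bi_asymptotic_shift[OF x0 gf[OF x0]] by blast
    let ?p = "\<lambda>x. shift k (g0 (f x))"
    have p: "block_map A X A X (shift k \<circ> (g0 \<circ> f))"
      by (intro block_map_comp[OF _ block_map_shift_self[OF X]] block_map_comp[OF f g0])
    note p_in = subshift_shift[OF X gf, of _ k]
    have "bi_asymptotic X x (?p x)" if x: "x \<in> X" for x
    proof -
      \<comment> \<open>The chain runs from \<open>x\<close> to \<open>shift j x0\<close>, by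
        equivariance to its image under \<open>?p\<close>, and back to \<open>?p x\<close> because
        \<open>?p\<close> preserves the relation.\<close>
      obtain j where j: "bi_asymptotic X x (shift j x0)"
        using X.ex_bi_asymptotic_shift[OF x x0] by blast
      have x0j: "shift j x0 \<in> X" using subshift_shift[OF X x0] .
      have "bi_asymptotic X (?p x) (?p (shift j x0))"
        using bi_asymptotic_block_map[OF p X x x0j j] by simp
      then have "bi_asymptotic X (?p (shift j x0)) (?p x)"
        by (rule X.bi_asymptotic_sym[OF p_in[OF x] p_in[OF x0j]])
      moreover have "bi_asymptotic X (shift j x0) (?p (shift j x0))"
        using bi_asymptotic_shift[OF X k, of j] block_map_shift[OF p X x0, of j] by simp
      ultimately show ?thesis
        using j X.bi_asymptotic_trans p_in x x0j by meson
    qed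
    then show thesis using that by blast
  qed
  define g where "g = shift k \<circ> g0"
  have g: "block_map B Y A X g"
    unfolding g_def by (rule block_map_comp[OF g0 block_map_shift_self[OF X]])
  have gf: "bi_asymptotic X (g (f x)) x" if "x \<in> X" for x
    using k that X.bi_asymptotic_sym block_map_in[OF g Y block_map_in[OF f X that]]
    by (simp add: g_def)
  have fg: "bi_asymptotic Y (f (g y)) y" if y: "y \<in> Y" for y
  proof -
    \<comment> \<open>Only some point of \<open>X\<close> is wanted here, so that shifts of
      \<open>f x\<close> can serve as reference points in \<open>Y\<close>; \<open>g y\<close> is
      one at hand.\<close>
    define x where "x = g y"
    have x: "x \<in> X" unfolding x_def by (rule block_map_in[OF g Y y])
    have fx: "f x \<in> Y" by (rule block_map_in[OF f X x])
    have fg: "block_map B Y B Y (f \<circ> g)" by (rule block_map_comp[OF g f])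
    obtain j where j: "bi_asymptotic Y y (shift j (f x))"
      using Y.ex_bi_asymptotic_shift[OF y fx] by blast
    have fxj: "shift j (f x) \<in> Y" by (rule subshift_shift[OF Y fx])
    have ffg: "f (g y) \<in> Y" "f (g (shift j (f x))) \<in> Y"
      using block_map_in[OF fg Y] y fxj by auto
    have "bi_asymptotic Y (f (g y)) (f (g (shift j (f x))))"
      using bi_asymptotic_block_map[OF fg Y y fxj j] by simp
    moreover have "bi_asymptotic Y (f (g (shift j (f x)))) (shift j (f x))"
    proof -
      \<comment> \<open>Image under \<open>f\<close> of the relation already known between
        \<open>g (f x)\<close> and \<open>x\<close>.\<close>
      have "bi_asymptotic Y (f (g (f x))) (f x)"
        using bi_asymptotic_block_map[OF f X _ x gf[OF x]] block_map_in[OF g Y fx] by blast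
      then have "bi_asymptotic Y (shift j (f (g (f x)))) (shift j (f x))"
        by (rule bi_asymptotic_shift[OF Y])
      then show ?thesis using block_map_shift[OF fg Y fx, of j] by simp
    qed
    moreover have "bi_asymptotic Y (shift j (f x)) y"
      by (rule Y.bi_asymptotic_sym[OF y fxj j])
    ultimately show ?thesis using Y.bi_asymptotic_trans y fxj ffg by meson
  qed
  have "homotopic_block_maps A X A X (g \<circ> f) id"
    by (rule X.homotopic_of_bi_asymptotic[OF X block_map_comp[OF f g] block_map_id])
       (simp add: gf)
  moreover have "homotopic_block_maps B Y B Y (f \<circ> g) id"
    by (rule Y.homotopic_of_bi_asymptotic[OF Y block_map_comp[OF g f] block_map_id])
       (simp add: fg)
  ultimately show "homotopy_equivalent_subshifts A X B Y"
    unfolding homotopy_equivalent_subshifts_def using f g by blast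
qed

end
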